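(* Let $\Omega\subseteq[n]\times[p]$ be the index set of $m:=|\Omega|$ observed entries $\{A_{ij}\}_{(i,j)\in\Omega}$. For $z\ge0$ let $\mathcal{D}(z):=\{X\in\mathbb{R}^{n\times p}:\ \operatorname{rank}(X)\le k,\ \|X\|_*\le z\}$. Consider the problem (Matrix Completion) $$\min_{z\in\mathbb{R}_+,\,X\in\mathcal{D}(z)}\{z:\ X_{ij}=A_{ij},\ \forall(i,j)\in\Omega\}$$ and its relaxation (Matrix Completion-R) $$V_{\rm rel}:=\min_{z\in\mathbb{R}_+,\,X\in\operatorname{conv}(\mathcal{D}(z))}\{z:\ X_{ij}=A_{ij},\ \forall(i,j)\in\Omega\},\qquad \operatorname{conv}(\mathcal{D}(z))=\{X\in\mathbb{R}^{n\times p}:\ \|X\|_*\le z\}.$$ Then there exists an optimal solution $(X,z)$ of Matrix Completion-R such that $X$ has rank at most $\lfloor\sqrt{2|\Omega|+9/4}-1/2\rfloor$. Moreover, if $|\Omega|\le(k+1)(k+2)/2-2$, then Matrix Completion-R achieves the same optimal value as Matrix Completion.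
   Context: $k\le n\le p$ are positive integers; $[n]=\{1,\dots,n\}$; $A_{ij}\in\mathbb{R}$; $\|X\|_*$ is the nuclear norm (sum of singular values); $\operatorname{conv}$ denotes convex hull. *)

theory Defs
  imports "HOL-Analysis.Analysis"
begin

definition right_singular_space :: "real^'p^'n \<Rightarrow> real \<Rightarrow> (real^'p) set" where
  "right_singular_space X s = {v. (transpose X ** X) *v v = s\<^sup>2 *\<^sub>R v}"

definition singular_values :: "real^'p^'n \<Rightarrow> real set" where
  "singular_values X = {s. s \<ge> 0 \<and> (\<exists>v. v \<noteq> 0 \<and> v \<in> right_singular_space X s)}"

(* Since X^T X is symmetric, the multiplicity of an eigenvalue is the dimension of its
   eigenspace, so each singular value is counted with that multiplicity. *)
definition nuclear_norm :: "real^'p^'n \<Rightarrow> real" where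
  "nuclear_norm X = (\<Sum>s\<in>singular_values X. real (dim (right_singular_space X s)) * s)"

(* The sum in nuclear_norm therefore never takes the default value of an infinite sum. *)
lemma finite_singular_values: "finite (singular_values X)"
proof -
  define e where "e s = (SOME v. v \<noteq> 0 \<and> v \<in> right_singular_space X s)" for s
  have e: "e s \<noteq> 0" "(transpose X ** X) *v e s = s\<^sup>2 *\<^sub>R e s" "s \<ge> 0"
    if "s \<in> singular_values X" for s
  proof -
    have "\<exists>v. v \<noteq> 0 \<and> v \<in> right_singular_space X s"
      using that by (simp add: singular_values_def)
    from someI_ex[OF this] show "e s \<noteq> 0" "(transpose X ** X) *v e s = s\<^sup>2 *\<^sub>R e s"
      by (simp_all add: e_def right_singular_space_def)
    show "s \<ge> 0" using that by (simp add: singular_values_def)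
  qed
  have orth: "e s \<bullet> e t = 0"
    if "s \<in> singular_values X" "t \<in> singular_values X" "s \<noteq> t" for s t
  proof -
    have "s\<^sup>2 * (e s \<bullet> e t) = ((transpose X ** X) *v e s) \<bullet> e t"
      using e(2)[OF that(1)] by simp
    also have "\<dots> = e s \<bullet> ((transpose X ** X) *v e t)"
      by (simp add: dot_lmul_matrix flip: matrix_vector_mul_assoc)
         (metis dot_lmul_matrix inner_commute transpose_matrix_vector transpose_transpose)
    also have "\<dots> = t\<^sup>2 * (e s \<bullet> e t)"
      using e(2)[OF that(2)] by simp
    finally show ?thesis
      using that e(3)[OF that(1)] e(3)[OF that(2)] by simp
  qed
  have "inj_on e (singular_values X)"
    by (rule inj_onI) (metis orth e(1) inner_eq_zero_iff)
  moreover have "finite (e ` singular_values X)"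
    by (rule pairwise_orthogonal_imp_finite)
       (auto simp: pairwise_def orthogonal_def intro: orth)
  ultimately show ?thesis
    using finite_image_iff by blast
qed

definition low_rank_ball :: "nat \<Rightarrow> real \<Rightarrow> (real^'p^'n) set" where
  "low_rank_ball k z = {X. rank X \<le> k \<and> nuclear_norm X \<le> z}"

definition agrees_on :: "('n \<times> 'p) set \<Rightarrow> real^'p^'n \<Rightarrow> real^'p^'n \<Rightarrow> bool" where
  "agrees_on \<Omega> A X \<longleftrightarrow> (\<forall>(i, j)\<in>\<Omega>. X $ i $ j = A $ i $ j)"

definition MC_feasible ::
    "nat \<Rightarrow> ('n \<times> 'p) set \<Rightarrow> real^'p^'n \<Rightarrow> ((real^'p^'n) \<times> real) set" where
  "MC_feasible k \<Omega> A = {(X, z). z \<ge> 0 \<and> X \<in> low_rank_ball k z \<and> agrees_on \<Omega> A X}"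

definition MCR_feasible ::
    "nat \<Rightarrow> ('n \<times> 'p) set \<Rightarrow> real^'p^'n \<Rightarrow> ((real^'p^'n) \<times> real) set" where
  "MCR_feasible k \<Omega> A =
     {(X, z). z \<ge> 0 \<and> X \<in> convex hull (low_rank_ball k z) \<and> agrees_on \<Omega> A X}"

(* The objective is z. Taken in the extended reals, so that an infeasible problem has
   optimal value infinity; Matrix Completion can be infeasible because of the rank bound. *)
definition optimal_value :: "('m \<times> real) set \<Rightarrow> ereal" where
  "optimal_value F = (INF (X, z)\<in>F. ereal z)"

definition optimal_solution :: "('m \<times> real) set \<Rightarrow> 'm \<Rightarrow> real \<Rightarrow> bool" where
  "optimal_solution F X z \<longleftrightarrow> (X, z) \<in> F \<and> (\<forall>(Y, w)\<in>F. z \<le> w)"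

end

theory Submission
  imports Defs
begin

text \<open>
  The nuclear norm is dual to the operator norm: \<open>nuclear_norm X\<close> is the maximum of \<open>X \<bullet> W\<close> over
  all contractions \<open>W\<close>. The maximum is attained at the partial isometry of the polar
  decomposition, which is built on an orthonormal eigenbasis of \<open>transpose X ** X\<close>; the images of
  such a basis under \<open>X\<close> are pairwise orthogonal, and their lengths are the singular values with
  multiplicity. Being a maximum of linear functionals, the nuclear norm is convex, hence
  continuous, and a ball of it contains the convex hull of its low-rank part. Conversely the
  singular value decomposition writes a matrix as a convex combination of rank-one matrices of
  the same nuclear norm, so for \<open>k \<ge> 1\<close> the convex hull is the whole ball. The relaxation thus
  minimises the nuclear norm subject to the observed entries, and compactness gives a minimiser.

  The rank bound comes from \<open>rank_reduction\<close>. Write \<open>X = W ** H\<close> with \<open>W\<close> a contraction and \<open>H\<close>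
  positive semidefinite, and let \<open>R\<close> be the orthogonal complement of the kernel of \<open>X\<close>, of dimension
  \<open>r = rank X\<close>. The symmetric matrices living on \<open>R\<close> form a space of dimension \<open>r * (r + 1) / 2\<close>.
  If this exceeds \<open>card \<Omega> + 1\<close>, some nonzero \<open>S\<close> among them has trace zero and leaves all observed
  entries of \<open>W ** (H + t *\<^sub>R S)\<close> unchanged. Having trace zero, \<open>S\<close> has a negative direction, so
  \<open>H + t *\<^sub>R S\<close> reaches the boundary of the positive semidefinite cone of \<open>R\<close> at some finite \<open>t\<close>.
  There a new kernel vector appears and the rank has dropped, while the nuclear norm is still at
  most the trace of \<open>H + t *\<^sub>R S\<close>, which is the nuclear norm of \<open>X\<close>. Hence a minimiser of least rank
  satisfies \<open>r * (r + 1) / 2 \<le> card \<Omega> + 1\<close>, which is the claimed bound; for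
  \<open>card \<Omega> \<le> (k + 1) * (k + 2) / 2 - 2\<close> it forces \<open>r \<le> k\<close>, so this minimiser is feasible for the
  problem with the rank constraint.
\<close>

section \<open>The spectral theorem for self-adjoint maps\<close>

definition orthonormal_basis_of :: "'a::euclidean_space set \<Rightarrow> 'a set \<Rightarrow> bool" where
  "orthonormal_basis_of S B \<longleftrightarrow>
     pairwise orthogonal B \<and> (\<forall>b\<in>B. norm b = 1) \<and> span B = S"

text \<open>
  Near \<open>t = 0\<close> the linear term dominates, so a nonzero slope would make one side negative.
\<close>

lemma quadratic_nonneg_imp_linear_zero:
  fixes a c :: real
  assumes "\<And>t. 0 \<le> t * a + t\<^sup>2 * c"
  shows "a = 0"
proof (rule ccontr)
  assume "a \<noteq> 0"
  define d where "d = \<bar>c\<bar> + 1"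
  have d: "d > 0" "c < d" by (auto simp: d_def)
  have "0 \<le> (- a / d) * a + (- a / d)\<^sup>2 * c"
    by (rule assms)
  also have "\<dots> = (a\<^sup>2 / d\<^sup>2) * (c - d)"
    using d by (simp add: field_simps power2_eq_square)
  also have "\<dots> < 0"
    using d \<open>a \<noteq> 0\<close> by (intro mult_pos_neg) auto
  finally show False by simp
qed

text \<open>
  A zero \<open>u\<close> of a nonnegative quadratic form is a minimum, so the derivative \<open>2 * (f u \<bullet> y)\<close> of the
  form vanishes at \<open>u\<close> in every direction \<open>y\<close> of \<open>S\<close>, in particular for \<open>y = f u\<close>.
\<close>

lemma semidefinite_zero_imp_kernel:
  fixes f :: "'a::euclidean_space \<Rightarrow> 'a"
  assumes "linear f" and sym: "\<And>x y. x \<bullet> f y = f x \<bullet> y"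
    and S: "subspace S" "f ` S \<subseteq> S"
    and psd: "\<And>x. x \<in> S \<Longrightarrow> 0 \<le> x \<bullet> f x"
    and u: "u \<in> S" "u \<bullet> f u = 0"
  shows "f u = 0"
proof -
  interpret linear f by fact
  have fu: "f u \<in> S" using S u by auto
  have "0 \<le> t * (2 * (f u \<bullet> f u)) + t\<^sup>2 * (f u \<bullet> f (f u))" for t
  proof -
    have "u + t *\<^sub>R f u \<in> S"
      using S fu u by (simp add: subspace_add subspace_scale)
    from psd[OF this] show ?thesis
      using u sym[of "f u" u] sym[of u "f u"]
      by (simp add: add scale inner_add_left inner_add_right power2_eq_square algebra_simps)
  qed
  then have "2 * (f u \<bullet> f u) = 0"
    by (rule quadratic_nonneg_imp_linear_zero)
  then show ?thesis by simp
qed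

text \<open>
  A maximiser \<open>u\<close> of the Rayleigh quotient on the unit sphere of \<open>S\<close> is an eigenvector: with \<open>\<mu>\<close> the
  maximum, \<open>\<mu> *\<^sub>R x - f x\<close> induces a nonnegative form on \<open>S\<close> that vanishes at \<open>u\<close>.
\<close>

lemma exists_eigenvector_in_subspace:
  fixes f :: "'a::euclidean_space \<Rightarrow> 'a"
  assumes "linear f" and sym: "\<And>x y. x \<bullet> f y = f x \<bullet> y"
    and S: "subspace S" "f ` S \<subseteq> S" and nz: "S \<noteq> {0}"
  obtains u where "u \<in> S" "norm u = 1" "f u = (u \<bullet> f u) *\<^sub>R u"
proof -
  let ?K = "sphere 0 1 \<inter> S"
  obtain a where a: "a \<in> S" "a \<noteq> 0"
    using nz subspace_0[OF S(1)] by auto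
  then have ne: "(1 / norm a) *\<^sub>R a \<in> ?K"
    using S by (simp add: subspace_scale)
  have "compact ?K"
    by (intro compact_Int_closed compact_sphere closed_subspace S)
  moreover have "continuous_on ?K (\<lambda>x. x \<bullet> f x)"
    using \<open>linear f\<close>
    by (intro continuous_on_inner continuous_on_id linear_continuous_on)
       (simp add: linear_conv_bounded_linear)
  ultimately obtain u where u: "u \<in> S" "norm u = 1"
    and max: "\<And>x. x \<in> ?K \<Longrightarrow> x \<bullet> f x \<le> u \<bullet> f u"
    using continuous_attains_sup[of ?K "\<lambda>x. x \<bullet> f x"] ne
    by (metis IntE empty_iff mem_sphere_0)
  define \<mu> where "\<mu> = u \<bullet> f u"
  interpret f: linear f by fact
  have "\<mu> *\<^sub>R u - f u = 0"
  proof (rule semidefinite_zero_imp_kernel[where S = S and f = "\<lambda>x. \<mu> *\<^sub>R x - f x"])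
    show "linear (\<lambda>x. \<mu> *\<^sub>R x - f x)"
      by (intro linear_compose_sub linear_scale_self \<open>linear f\<close>)
    show "x \<bullet> (\<mu> *\<^sub>R y - f y) = (\<mu> *\<^sub>R x - f x) \<bullet> y" for x y
      by (simp add: sym inner_diff_left inner_diff_right)
    show "(\<lambda>x. \<mu> *\<^sub>R x - f x) ` S \<subseteq> S"
      using S by (auto intro!: subspace_diff subspace_scale)
    show "0 \<le> x \<bullet> (\<mu> *\<^sub>R x - f x)" if "x \<in> S" for x
    proof (cases "x = 0")
      case False
      define y where "y = (1 / norm x) *\<^sub>R x"
      have "y \<in> ?K" using that False S by (simp add: y_def subspace_scale)
      then have "y \<bullet> f y \<le> \<mu>" by (simp add: max \<mu>_def)
      moreover have "x = norm x *\<^sub>R y" using False by (simp add: y_def)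
      then have "x \<bullet> f x = (norm x)\<^sup>2 * (y \<bullet> f y)"
        by (metis f.scale inner_scaleR_left inner_scaleR_right mult.assoc power2_eq_square)
      ultimately show ?thesis
        using mult_left_mono[of "y \<bullet> f y" \<mu> "(norm x)\<^sup>2"]
        by (simp add: inner_diff_right dot_square_norm mult.commute)
    qed simp
    show "u \<bullet> (\<mu> *\<^sub>R u - f u) = 0"
      using u by (simp add: inner_diff_right dot_square_norm \<mu>_def)
  qed (use S u in auto)
  then show thesis using that u by (simp add: \<mu>_def)
qed

text \<open>
  Split off an eigenvector \<open>u\<close>; self-adjointness makes the orthogonal complement of \<open>u\<close> in \<open>S\<close>
  invariant again, and its dimension is smaller.
\<close>

proposition spectral_theorem_self_adjoint:
  fixes f :: "'a::euclidean_space \<Rightarrow> 'a"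
  assumes "linear f" and sym: "\<And>x y. x \<bullet> f y = f x \<bullet> y"
    and S: "subspace S" "f ` S \<subseteq> S"
  shows "\<exists>B. orthonormal_basis_of S B \<and> (\<forall>b\<in>B. f b = (b \<bullet> f b) *\<^sub>R b)"
  using S
proof (induction "dim S" arbitrary: S rule: less_induct)
  case less
  show ?case
  proof (cases "S = {0}")
    case True
    then show ?thesis by (intro exI[of _ "{}"]) (auto simp: orthonormal_basis_of_def)
  next
    case False
    obtain u where u: "u \<in> S" "norm u = 1" "f u = (u \<bullet> f u) *\<^sub>R u"
      using exists_eigenvector_in_subspace[OF assms(1) sym less.prems False] by blast
    define T where "T = {x \<in> S. u \<bullet> x = 0}"
    have T: "subspace T"
      unfolding T_def using subspace_inter[OF less.prems(1) subspace_hyperplane[of u]]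
      by (simp add: Int_def)
    have "u \<notin> T" using u by (auto simp: T_def)
    moreover have "T \<subseteq> S" by (auto simp: T_def)
    ultimately have "T \<subset> S" using u by blast
    then have "dim T < dim S"
      using T less.prems by (intro dim_psubset) (simp add: span_eq_iff[THEN iffD2])
    moreover have "f ` T \<subseteq> T"
    proof clarify
      fix x assume x: "x \<in> T"
      have "u \<bullet> f x = f u \<bullet> x" by (rule sym)
      also have "\<dots> = 0" using x by (subst u(3)) (simp add: T_def)
      finally show "f x \<in> T" using x less.prems by (auto simp: T_def)
    qed
    ultimately obtain B where B: "orthonormal_basis_of T B" "\<forall>b\<in>B. f b = (b \<bullet> f b) *\<^sub>R b"
      using less.hyps T by blast
    have BT: "B \<subseteq> T" using B by (auto simp: orthonormal_basis_of_def span_base)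
    have "span (insert u B) = S"
    proof
      show "span (insert u B) \<subseteq> S"
        using u BT less.prems by (intro span_minimal) (auto simp: T_def)
      show "S \<subseteq> span (insert u B)"
      proof
        fix x assume "x \<in> S"
        then have "x - (u \<bullet> x) *\<^sub>R u \<in> T"
          using u less.prems
          by (simp add: T_def subspace_diff subspace_scale inner_diff_right dot_square_norm)
        then show "x \<in> span (insert u B)"
          using B by (auto simp: span_insert orthonormal_basis_of_def)
      qed
    qed
    then have "orthonormal_basis_of S (insert u B)"
      using B u BT
      by (auto simp: orthonormal_basis_of_def pairwise_insert orthogonal_def inner_commute T_def)
    then show ?thesis using B u by blast
  qed
qed

section \<open>Orthonormal bases and rank-one matrices\<close>

context
  fixes B :: "'a::euclidean_space set"
  assumes B: "orthonormal_basis_of UNIV B"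
begin

lemma onb_finite: "finite B"
  using B pairwise_orthogonal_imp_finite by (auto simp: orthonormal_basis_of_def)

lemma onb_norm: "b \<in> B \<Longrightarrow> norm b = 1"
  using B by (auto simp: orthonormal_basis_of_def)

lemma onb_inner: "b \<in> B \<Longrightarrow> c \<in> B \<Longrightarrow> b \<bullet> c = (if b = c then 1 else 0)"
  using B onb_norm by (auto simp: orthonormal_basis_of_def pairwise_def orthogonal_def dot_square_norm)

lemma onb_expand: "(\<Sum>b\<in>B. (x \<bullet> b) *\<^sub>R b) = x"
  using B onb_finite by (intro orthonormal_basis_expand) (auto simp: orthonormal_basis_of_def)

lemma onb_parseval: "x \<bullet> y = (\<Sum>b\<in>B. (x \<bullet> b) * (y \<bullet> b))"
proof -
  have "x \<bullet> y = (\<Sum>b\<in>B. (x \<bullet> b) *\<^sub>R b) \<bullet> y" by (simp add: onb_expand)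
  also have "\<dots> = (\<Sum>b\<in>B. (x \<bullet> b) * (y \<bullet> b))"
    by (simp only: inner_sum_left inner_scaleR_left inner_commute[of y])
  finally show ?thesis .
qed

lemma onb_expand_linear:
  assumes "linear f"
  shows "f x = (\<Sum>b\<in>B. (x \<bullet> b) *\<^sub>R f b)"
proof -
  have "f x = f (\<Sum>b\<in>B. (x \<bullet> b) *\<^sub>R b)" by (simp only: onb_expand)
  also have "\<dots> = (\<Sum>b\<in>B. (x \<bullet> b) *\<^sub>R f b)"
    by (simp only: linear_sum[OF assms] linear_scale[OF assms])
  finally show ?thesis .
qed

end

text \<open>
  The inner product of matrices is \<open>trace (transpose X ** W)\<close>, and a trace can be computed in any
  orthonormal basis. For \<open>X = mat 1\<close> the left-hand side is the trace of \<open>W\<close>.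
\<close>

lemma matrix_inner_parseval:
  fixes X W :: "real^'p^'n"
  assumes "orthonormal_basis_of UNIV B"
  shows "X \<bullet> W = (\<Sum>b\<in>B. (X *v b) \<bullet> (W *v b))"
proof -
  have "X \<bullet> W = (\<Sum>i\<in>UNIV. \<Sum>b\<in>B. (X $ i \<bullet> b) * (W $ i \<bullet> b))"
    by (simp add: inner_vec_def[of X W] onb_parseval[OF assms, symmetric])
  also have "\<dots> = (\<Sum>b\<in>B. \<Sum>i\<in>UNIV. (X $ i \<bullet> b) * (W $ i \<bullet> b))"
    by (rule sum.swap)
  also have "\<dots> = (\<Sum>b\<in>B. (X *v b) \<bullet> (W *v b))"
    by (simp add: inner_vec_def[of "X *v _"] matrix_vector_mul_component)
  finally show ?thesis .
qed

definition outer_product :: "real^'n \<Rightarrow> real^'p \<Rightarrow> real^'p^'n" where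
  "outer_product u v = (\<chi> i j. u $ i * v $ j)"

lemma outer_product_mult_vector: "outer_product u v *v x = (v \<bullet> x) *\<^sub>R u"
  by (simp add: vec_eq_iff outer_product_def matrix_vector_mult_def inner_vec_def
      sum_distrib_right sum_distrib_left mult.assoc mult.commute mult.left_commute)

lemma transpose_outer_product: "transpose (outer_product u v) = outer_product v u"
  by (simp add: outer_product_def transpose_def vec_eq_iff mult.commute)

lemma inner_outer_product:
  fixes W :: "real^'p^'n"
  shows "outer_product u v \<bullet> W = u \<bullet> (W *v v)"
  by (simp add: inner_vec_def outer_product_def matrix_vector_mult_def sum_distrib_left
      mult.assoc mult.commute mult.left_commute)

lemma rank_outer_product: "rank (outer_product u v) \<le> 1"
proof -
  have "rank (outer_product u v) \<le> dim {u}"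
    unfolding rank_dim_range
    by (intro dim_mono) (auto simp: outer_product_mult_vector intro: span_scale span_base)
  also have "\<dots> \<le> 1" using dim_le_card'[of "{u}"] by simp
  finally show ?thesis .
qed

lemma matrix_vector_inner_transpose:
  fixes Q :: "real^'p^'n"
  shows "x \<bullet> (Q *v y) = (transpose Q *v x) \<bullet> y"
  by (simp add: dot_lmul_matrix)

text \<open>
  The kernel is the orthogonal complement of the row space.
\<close>

lemma rank_plus_nullity:
  fixes A :: "real^'p^'n"
  shows "dim {x. A *v x = 0} + rank A = CARD('p)"
proof -
  have "{x. A *v x = 0} = {y \<in> UNIV. \<forall>x \<in> span (rows A). orthogonal x y}"
  proof (intro equalityI subsetI)
    fix x assume "x \<in> {x. A *v x = 0}"
    then show "x \<in> {y \<in> UNIV. \<forall>x \<in> span (rows A). orthogonal x y}"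
      using orthogonal_nullspace_rowspace[of A x] orthogonal_commute[of x] by blast
  next
    fix x assume x: "x \<in> {y \<in> UNIV. \<forall>x \<in> span (rows A). orthogonal x y}"
    have "(A *v x) $ i = 0" for i
    proof -
      have "A $ i \<in> span (rows A)"
        by (rule span_base) (auto simp: rows_def row_def vec_lambda_eta)
      then show ?thesis using x by (simp add: matrix_vector_mul_component orthogonal_def)
    qed
    then show "x \<in> {x. A *v x = 0}" by (simp add: vec_eq_iff)
  qed
  then show ?thesis
    using dim_subspace_orthogonal_to_vectors[of "span (rows A)" UNIV]
    by (simp add: row_rank_def)
qed

lemma rank_less_if_kernel_less:
  fixes X Y :: "real^'p^'n"
  assumes "{x. X *v x = 0} \<subset> {x. Y *v x = 0}"
  shows "rank Y < rank X"
proof -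
  have "subspace {x. A *v x = 0}" for A :: "real^'p^'n"
    by (auto simp: subspace_def matrix_vector_right_distrib matrix_vector_mult_scaleR)
  then have "dim {x. X *v x = 0} < dim {x. Y *v x = 0}"
    using assms by (intro dim_psubset) (simp add: span_eq_iff[THEN iffD2])
  then show ?thesis using rank_plus_nullity[of X] rank_plus_nullity[of Y] by linarith
qed


lemma sum_matrix_vector_mult:
  fixes f :: "'a \<Rightarrow> real^'p^'n"
  shows "sum f S *v x = (\<Sum>i\<in>S. f i *v x)"
  by (induction S rule: infinite_finite_induct)
     (simp_all add: matrix_vector_mult_add_rdistrib)

lemma matrix_eq_on_onb:
  fixes X Y :: "real^'p^'n"
  assumes "orthonormal_basis_of UNIV B" and "\<And>b. b \<in> B \<Longrightarrow> X *v b = Y *v b"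
  shows "X = Y"
proof -
  have "X *v v = Y *v v" for v
    using onb_expand_linear[OF assms(1), of "(*v) X" v]
      onb_expand_linear[OF assms(1), of "(*v) Y" v] assms(2)
    by simp
  then show ?thesis by (simp add: matrix_eq)
qed

lemma spectral_theorem_symmetric_matrix:
  fixes Q :: "real^'p^'p"
  assumes "transpose Q = Q"
  obtains B where "orthonormal_basis_of UNIV B" "\<And>b. b \<in> B \<Longrightarrow> Q *v b = (b \<bullet> (Q *v b)) *\<^sub>R b"
  using spectral_theorem_self_adjoint[of "(*v) Q" UNIV] assms
    matrix_vector_inner_transpose[of _ Q]
  by auto

section \<open>Right singular bases and the polar factor\<close>

text \<open>
  These are the orthonormal bases of right singular vectors. An eigenvalue of the Gram matrix at a
  unit eigenvector \<open>b\<close> is necessarily \<open>(norm (X *v b))\<^sup>2\<close>, so the singular value needs no name.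
\<close>

definition singular_basis :: "real^'p^'n \<Rightarrow> (real^'p) set \<Rightarrow> bool" where
  "singular_basis X B \<longleftrightarrow> orthonormal_basis_of UNIV B \<and>
     (\<forall>b\<in>B. (transpose X ** X) *v b = (norm (X *v b))\<^sup>2 *\<^sub>R b)"

lemma inner_gram_matrix:
  fixes X :: "real^'p^'n"
  shows "x \<bullet> ((transpose X ** X) *v y) = (X *v x) \<bullet> (X *v y)"
  by (simp only: matrix_vector_mul_assoc[symmetric] matrix_vector_inner_transpose transpose_transpose)

lemma exists_singular_basis:
  fixes X :: "real^'p^'n"
  obtains B where "singular_basis X B"
proof -
  have "transpose (transpose X ** X) = transpose X ** X"
    by (simp only: matrix_transpose_mul transpose_transpose)
  then obtain B where "orthonormal_basis_of UNIV B"
    "\<And>b. b \<in> B \<Longrightarrow> (transpose X ** X) *v b = (b \<bullet> ((transpose X ** X) *v b)) *\<^sub>R b"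
    using spectral_theorem_symmetric_matrix by blast
  then show thesis
    using that by (auto simp: singular_basis_def inner_gram_matrix dot_square_norm)
qed

context
  fixes X :: "real^'p^'n" and B :: "(real^'p) set"
  assumes SB: "singular_basis X B"
begin

lemma singular_basis_onb: "orthonormal_basis_of UNIV B"
  using SB by (simp add: singular_basis_def)

lemmas singular_basis_finite = onb_finite[OF singular_basis_onb]
lemmas singular_basis_norm = onb_norm[OF singular_basis_onb]

lemma singular_basis_images_orthogonal:
  assumes "b \<in> B" "c \<in> B" "b \<noteq> c"
  shows "(X *v b) \<bullet> (X *v c) = 0"
proof -
  have "(X *v b) \<bullet> (X *v c) = b \<bullet> ((norm (X *v c))\<^sup>2 *\<^sub>R c)"
    using SB assms by (simp only: inner_gram_matrix[symmetric] singular_basis_def)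
  then show ?thesis using assms onb_inner[OF singular_basis_onb, of b c] by simp
qed

text \<open>
  A component of \<open>v\<close> along a basis vector with another singular value vanishes, since eigenvectors
  of a symmetric matrix for distinct eigenvalues are orthogonal.
\<close>

lemma right_singular_space_eq_span:
  assumes "s \<ge> 0"
  shows "right_singular_space X s = span {b \<in> B. norm (X *v b) = s}"
proof
  have "subspace (right_singular_space X s)"
    by (auto simp: right_singular_space_def subspace_def matrix_vector_right_distrib
        matrix_vector_mult_scaleR scaleR_add_right)
  then show "span {b \<in> B. norm (X *v b) = s} \<subseteq> right_singular_space X s"
    using SB by (intro span_minimal) (auto simp: right_singular_space_def singular_basis_def)
next
  show "right_singular_space X s \<subseteq> span {b \<in> B. norm (X *v b) = s}"
  proof
    fix v assume v: "v \<in> right_singular_space X s"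
    have "(v \<bullet> b) *\<^sub>R b \<in> span {b \<in> B. norm (X *v b) = s}" if "b \<in> B" for b
    proof (cases "norm (X *v b) = s")
      case True
      then show ?thesis using that by (intro span_scale span_base) auto
    next
      case False
      have "b \<bullet> ((transpose X ** X) *v v) = ((transpose X ** X) *v b) \<bullet> v"
        by (metis inner_commute inner_gram_matrix)
      then have "s\<^sup>2 * (b \<bullet> v) = (norm (X *v b))\<^sup>2 * (b \<bullet> v)"
        using v SB that by (simp add: right_singular_space_def singular_basis_def)
      then have "b \<bullet> v = 0" using False assms by auto
      then show ?thesis by (simp add: inner_commute span_zero)
    qed
    then have "(\<Sum>b\<in>B. (v \<bullet> b) *\<^sub>R b) \<in> span {b \<in> B. norm (X *v b) = s}"
      by (rule span_sum)
    then show "v \<in> span {b \<in> B. norm (X *v b) = s}"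
      by (simp add: onb_expand[OF singular_basis_onb])
  qed
qed

lemma dim_right_singular_space:
  assumes "s \<ge> 0"
  shows "dim (right_singular_space X s) = card {b \<in> B. norm (X *v b) = s}"
proof -
  have "independent {b \<in> B. norm (X *v b) = s}"
    using singular_basis_onb
    by (intro pairwise_orthogonal_independent)
       (auto simp: orthonormal_basis_of_def pairwise_def)
  then show ?thesis
    by (simp add: right_singular_space_eq_span assms dim_span dim_eq_card_independent)
qed

lemma singular_values_eq_image: "singular_values X = (\<lambda>b. norm (X *v b)) ` B"
proof -
  have "(\<exists>v. v \<noteq> 0 \<and> v \<in> right_singular_space X s) \<longleftrightarrow> {b \<in> B. norm (X *v b) = s} \<noteq> {}"
    if "s \<ge> 0" for s
  proof
    assume "\<exists>v. v \<noteq> 0 \<and> v \<in> right_singular_space X s"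
    then show "{b \<in> B. norm (X *v b) = s} \<noteq> {}"
      using right_singular_space_eq_span[OF that]
      by (metis singletonD span_empty)
  next
    assume "{b \<in> B. norm (X *v b) = s} \<noteq> {}"
    then obtain b where b: "b \<in> B" "norm (X *v b) = s" by auto
    then have "b \<in> right_singular_space X s"
      by (auto simp: right_singular_space_eq_span that span_base)
    moreover have "b \<noteq> 0" using singular_basis_norm[OF b(1)] by auto
    ultimately show "\<exists>v. v \<noteq> 0 \<and> v \<in> right_singular_space X s" by blast
  qed
  then show ?thesis by (auto simp: singular_values_def)
qed

text \<open>
  Grouping the basis vectors by the length of their image recovers each singular value with the
  dimension of its singular space as multiplicity.
\<close>

lemma nuclear_norm_singular_basis: "nuclear_norm X = (\<Sum>b\<in>B. norm (X *v b))"
proof -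
  have "nuclear_norm X = (\<Sum>s\<in>(\<lambda>b. norm (X *v b)) ` B.
      real (card {b \<in> B. norm (X *v b) = s}) * s)"
    unfolding nuclear_norm_def singular_values_eq_image
    by (intro sum.cong) (auto simp: dim_right_singular_space)
  also have "\<dots> = (\<Sum>s\<in>(\<lambda>b. norm (X *v b)) ` B. \<Sum>b | b \<in> B \<and> norm (X *v b) = s. norm (X *v b))"
    by (intro sum.cong) auto
  also have "\<dots> = (\<Sum>b\<in>B. norm (X *v b))"
    by (rule sum.image_gen[OF singular_basis_finite, symmetric])
  finally show ?thesis .
qed

text \<open>
  The partial isometry \<open>W\<close> of the polar decomposition \<open>X = W ** sqrt (transpose X ** X)\<close>. On the
  kernel of \<open>X\<close> the convention \<open>1 / 0 = 0\<close> makes it vanish.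
\<close>

definition polar_factor :: "real^'p^'n" where
  "polar_factor = (\<Sum>b\<in>B. outer_product ((1 / norm (X *v b)) *\<^sub>R (X *v b)) b)"

lemma polar_factor_basis:
  assumes "b \<in> B"
  shows "polar_factor *v b = (1 / norm (X *v b)) *\<^sub>R (X *v b)"
proof -
  have "polar_factor *v b = (\<Sum>c\<in>B. (if c = b then (1 / norm (X *v b)) *\<^sub>R (X *v b) else 0))"
    unfolding polar_factor_def sum_matrix_vector_mult outer_product_mult_vector
    using assms by (intro sum.cong) (auto simp: onb_inner[OF singular_basis_onb])
  also have "\<dots> = (1 / norm (X *v b)) *\<^sub>R (X *v b)"
    using assms singular_basis_finite by simp
  finally show ?thesis .
qed

lemma polar_factor_contraction: "norm (polar_factor *v v) \<le> norm v"
proof -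
  have "polar_factor *v v = (\<Sum>b\<in>B. (v \<bullet> b) *\<^sub>R (polar_factor *v b))"
    by (rule onb_expand_linear[OF singular_basis_onb]) simp
  then have "(norm (polar_factor *v v))\<^sup>2 = (\<Sum>b\<in>B. (norm ((v \<bullet> b) *\<^sub>R (polar_factor *v b)))\<^sup>2)"
    using singular_basis_finite singular_basis_images_orthogonal
    by (simp add: norm_sum_Pythagorean pairwise_def orthogonal_def polar_factor_basis)
  also have "\<dots> \<le> (\<Sum>b\<in>B. (v \<bullet> b)\<^sup>2)"
    by (intro sum_mono) (auto simp: polar_factor_basis power_mult_distrib)
  also have "\<dots> = (norm v)\<^sup>2"
    using onb_parseval[OF singular_basis_onb, of v v]
    by (simp add: power2_eq_square flip: power2_norm_eq_inner)
  finally show ?thesis by (simp add: power2_le_iff_abs_le)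
qed

end

section \<open>Duality and its consequences for the nuclear norm\<close>

lemma inner_contraction_le_sum_norms:
  fixes X W :: "real^'p^'n"
  assumes "orthonormal_basis_of UNIV C" and W: "\<And>v. norm (W *v v) \<le> norm v"
  shows "X \<bullet> W \<le> (\<Sum>c\<in>C. norm (X *v c))"
proof -
  have "(X *v c) \<bullet> (W *v c) \<le> norm (X *v c)" if "c \<in> C" for c
  proof -
    have "(X *v c) \<bullet> (W *v c) \<le> norm (X *v c) * norm (W *v c)"
      by (rule norm_cauchy_schwarz)
    also have "\<dots> \<le> norm (X *v c) * 1"
      using W[of c] onb_norm[OF assms(1) that] by (intro mult_left_mono) auto
    finally show ?thesis by simp
  qed
  then show ?thesis
    by (simp add: matrix_inner_parseval[OF assms(1)] sum_mono)
qed

lemma inner_contraction_le_nuclear_norm: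
  fixes X W :: "real^'p^'n"
  assumes "\<And>v. norm (W *v v) \<le> norm v"
  shows "X \<bullet> W \<le> nuclear_norm X"
proof -
  obtain B where "singular_basis X B" by (rule exists_singular_basis)
  then show ?thesis
    using inner_contraction_le_sum_norms[of B W X] assms
    by (simp add: nuclear_norm_singular_basis singular_basis_onb)
qed

lemma nuclear_norm_attained:
  fixes X :: "real^'p^'n"
  obtains W :: "real^'p^'n" where "\<And>v. norm (W *v v) \<le> norm v" "nuclear_norm X = X \<bullet> W"
proof -
  obtain B where B: "singular_basis X B" by (rule exists_singular_basis)
  have "X \<bullet> polar_factor X B = (\<Sum>b\<in>B. norm (X *v b))"
    unfolding matrix_inner_parseval[OF singular_basis_onb[OF B]]
    by (intro sum.cong) (auto simp: polar_factor_basis[OF B] dot_square_norm power2_eq_square)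
  then show thesis
    using that[OF polar_factor_contraction[OF B]] by (simp add: nuclear_norm_singular_basis[OF B])
qed

text \<open>
  Singular bases minimise \<open>\<Sum>c\<in>C. norm (X *v c)\<close> over all orthonormal bases: evaluate the optimal
  dual matrix in the basis \<open>C\<close>.
\<close>

lemma nuclear_norm_le_sum_norms:
  fixes X :: "real^'p^'n"
  assumes "orthonormal_basis_of UNIV C"
  shows "nuclear_norm X \<le> (\<Sum>c\<in>C. norm (X *v c))"
proof -
  obtain W :: "real^'p^'n" where "\<And>v. norm (W *v v) \<le> norm v" "nuclear_norm X = X \<bullet> W"
    using nuclear_norm_attained by blast
  then show ?thesis using inner_contraction_le_sum_norms[OF assms] by metis
qed

lemma nuclear_norm_nonneg: "nuclear_norm X \<ge> 0"
  unfolding nuclear_norm_def by (intro sum_nonneg) (auto simp: singular_values_def)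

text \<open>
  The dual matrix that is optimal for a convex combination is admissible for both of its points.
\<close>

lemma convex_on_nuclear_norm: "convex_on UNIV (nuclear_norm :: real^'p^'n \<Rightarrow> real)"
proof (rule convex_onI)
  fix t :: real and X Y :: "real^'p^'n"
  assume t: "0 < t" "t < 1"
  obtain W :: "real^'p^'n" where W: "\<And>v. norm (W *v v) \<le> norm v"
    "nuclear_norm ((1 - t) *\<^sub>R X + t *\<^sub>R Y) = ((1 - t) *\<^sub>R X + t *\<^sub>R Y) \<bullet> W"
    using nuclear_norm_attained by blast
  have "((1 - t) *\<^sub>R X + t *\<^sub>R Y) \<bullet> W = (1 - t) * (X \<bullet> W) + t * (Y \<bullet> W)"
    by (simp add: inner_add_left)
  also have "\<dots> \<le> (1 - t) * nuclear_norm X + t * nuclear_norm Y"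
    using t W(1) by (intro add_mono mult_left_mono inner_contraction_le_nuclear_norm) auto
  finally show "nuclear_norm ((1 - t) *\<^sub>R X + t *\<^sub>R Y) \<le> (1 - t) * nuclear_norm X + t * nuclear_norm Y"
    using W(2) by simp
qed simp

lemma nuclear_norm_outer_product:
  fixes u :: "real^'n" and v :: "real^'p"
  shows "nuclear_norm (outer_product u v) \<le> norm u * norm v"
proof -
  obtain W :: "real^'p^'n" where W: "\<And>v. norm (W *v v) \<le> norm v"
    "nuclear_norm (outer_product u v) = outer_product u v \<bullet> W"
    using nuclear_norm_attained by blast
  have "outer_product u v \<bullet> W \<le> norm u * norm (W *v v)"
    by (simp add: inner_outer_product norm_cauchy_schwarz)
  also have "\<dots> \<le> norm u * norm v" by (intro mult_left_mono W) auto
  finally show ?thesis using W(2) by simp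
qed

lemma outer_product_expansion:
  fixes X :: "real^'p^'n"
  assumes "orthonormal_basis_of UNIV B"
  shows "X = (\<Sum>b\<in>B. outer_product (X *v b) b)"
proof (rule matrix_eq_on_onb[OF assms])
  fix c assume "c \<in> B"
  have "(\<Sum>b\<in>B. outer_product (X *v b) b) *v c = (\<Sum>b\<in>B. (c \<bullet> b) *\<^sub>R (X *v b))"
    by (simp add: sum_matrix_vector_mult outer_product_mult_vector inner_commute)
  then show "X *v c = (\<Sum>b\<in>B. outer_product (X *v b) b) *v c"
    using onb_expand_linear[OF assms, of "(*v) X" c] by simp
qed

lemma norm_outer_product: "norm (outer_product u v) = norm u * norm v"
proof -
  have "(norm (outer_product u v))\<^sup>2 = (norm u * norm v)\<^sup>2"
    by (simp add: power2_norm_eq_inner inner_outer_product outer_product_mult_vector power_mult_distrib)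
  then show ?thesis by simp
qed

text \<open>
  Triangle inequality in the singular value decomposition. This makes nuclear norm balls bounded.
\<close>

lemma norm_le_nuclear_norm:
  fixes X :: "real^'p^'n"
  shows "norm X \<le> nuclear_norm X"
proof -
  obtain B where B: "singular_basis X B" by (rule exists_singular_basis)
  have "norm X \<le> (\<Sum>b\<in>B. norm (outer_product (X *v b) b))"
    by (subst outer_product_expansion[OF singular_basis_onb[OF B]]) (rule norm_sum)
  also have "\<dots> = nuclear_norm X"
    by (simp add: nuclear_norm_singular_basis[OF B] norm_outer_product singular_basis_norm[OF B])
  finally show ?thesis .
qed

text \<open>
  With \<open>N\<close> the nuclear norm of \<open>X\<close>, the singular value decomposition is a convex combination of
  rank-one matrices of nuclear norm at most \<open>N\<close>, with weights \<open>norm (X *v b) / N\<close>.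
\<close>

proposition convex_hull_low_rank_ball:
  assumes "1 \<le> k"
  shows "convex hull (low_rank_ball k z) = {X :: real^'p^'n. nuclear_norm X \<le> z}"
proof
  have "convex {X :: real^'p^'n. nuclear_norm X \<le> z}"
  proof (rule convexI)
    fix X Y :: "real^'p^'n" and u v :: real
    assume *: "X \<in> {X. nuclear_norm X \<le> z}" "Y \<in> {X. nuclear_norm X \<le> z}"
      and uv: "0 \<le> u" "0 \<le> v" "u + v = 1"
    have "nuclear_norm (u *\<^sub>R X + v *\<^sub>R Y) \<le> u * nuclear_norm X + v * nuclear_norm Y"
      using convex_on_nuclear_norm uv by (auto simp: convex_on_def)
    also have "\<dots> \<le> z"
      using * uv by (intro convex_bound_le) auto
    finally show "u *\<^sub>R X + v *\<^sub>R Y \<in> {X. nuclear_norm X \<le> z}" by simp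
  qed
  then show "convex hull (low_rank_ball k z) \<subseteq> {X :: real^'p^'n. nuclear_norm X \<le> z}"
    by (intro hull_minimal) (auto simp: low_rank_ball_def)
next
  show "{X :: real^'p^'n. nuclear_norm X \<le> z} \<subseteq> convex hull (low_rank_ball k z)"
  proof clarify
    fix X :: "real^'p^'n" assume Xz: "nuclear_norm X \<le> z"
    define N where "N = nuclear_norm X"
    obtain B where B: "singular_basis X B" by (rule exists_singular_basis)
    note onb = singular_basis_onb[OF B]
    show "X \<in> convex hull (low_rank_ball k z)"
    proof (cases "N = 0")
      case True
      then have "X = 0" using norm_le_nuclear_norm[of X] by (simp add: N_def)
      then have "X \<in> low_rank_ball k z" using Xz by (simp add: low_rank_ball_def rank_0)
      then show ?thesis by (rule hull_inc)
    next
      case False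
      then have N: "N > 0" using nuclear_norm_nonneg[of X] by (simp add: N_def)
      define Y where "Y b = outer_product ((N / norm (X *v b)) *\<^sub>R (X *v b)) b" for b
      have "Y b \<in> low_rank_ball k z" if "b \<in> B" for b
      proof -
        have "nuclear_norm (Y b) \<le> norm ((N / norm (X *v b)) *\<^sub>R (X *v b)) * norm b"
          unfolding Y_def by (rule nuclear_norm_outer_product)
        also have "\<dots> \<le> N" using N that by (auto simp: singular_basis_norm[OF B])
        finally show ?thesis
          using rank_outer_product[of "(N / norm (X *v b)) *\<^sub>R (X *v b)" b] assms Xz
          by (simp add: low_rank_ball_def Y_def N_def)
      qed
      moreover have "(\<Sum>b\<in>B. norm (X *v b) / N) = 1"
        using False
        by (simp add: N_def nuclear_norm_singular_basis[OF B] flip: sum_divide_distrib)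
      ultimately have "(\<Sum>b\<in>B. (norm (X *v b) / N) *\<^sub>R Y b) \<in> convex hull (low_rank_ball k z)"
        using N singular_basis_finite[OF B]
        by (intro convex_sum) (auto intro: hull_inc)
      moreover have "(norm (X *v b) / N) *\<^sub>R Y b = outer_product (X *v b) b" for b
        using N by (auto simp: Y_def outer_product_def vec_eq_iff)
      ultimately show ?thesis
        using outer_product_expansion[OF onb, of X] by simp
    qed
  qed
qed

section \<open>Symmetric matrices: dimension count, definiteness and trace\<close>

text \<open>
  Fewer homogeneous linear equations than unknowns have a nontrivial solution.
\<close>

lemma exists_orthogonal_in_large_subspace:
  fixes V :: "'a::euclidean_space set"
  assumes "subspace V" "finite K" "card K < dim V"
  obtains x where "x \<in> V" "x \<noteq> 0" "\<And>k. k \<in> K \<Longrightarrow> k \<bullet> x = 0"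
proof -
  define N where "N = {y. \<forall>x\<in>span K. orthogonal x y}"
  have N: "subspace N"
    by (auto simp: N_def subspace_def orthogonal_def inner_add_right)
  have "dim N + dim K = DIM('a)"
    using dim_subspace_orthogonal_to_vectors[of "span K" UNIV] by (simp add: N_def)
  moreover have "dim K \<le> card K" using assms by (simp add: dim_le_card')
  moreover have "dim {x + y |x y. x \<in> V \<and> y \<in> N} + dim (V \<inter> N) = dim V + dim N"
    using assms N by (intro dim_sums_Int)
  moreover have "dim {x + y |x y. x \<in> V \<and> y \<in> N} \<le> DIM('a)"
    by (rule dim_subset_UNIV)
  ultimately have "dim (V \<inter> N) \<noteq> 0" using assms by linarith
  then obtain x where "x \<in> V \<inter> N" "x \<noteq> 0" by (auto simp: dim_eq_0)
  then show thesis using that by (auto simp: N_def orthogonal_def span_base)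
qed

text \<open>
  The symmetric matrices that vanish on the orthogonal complement of \<open>P\<close>, that is, the symmetric
  operators on \<open>span P\<close> extended by zero. Keeping them inside the matrices of full size avoids a
  matrix type whose dimension would depend on the rank.
\<close>

definition symmetric_matrices_on :: "(real^'p) set \<Rightarrow> (real^'p^'p) set" where
  "symmetric_matrices_on P =
     {S. transpose S = S \<and> (\<forall>w. (\<forall>b\<in>P. b \<bullet> w = 0) \<longrightarrow> S *v w = 0)}"

lemma transpose_add: "transpose (A + B) = transpose A + transpose (B :: real^'p^'n)"
  by (simp add: transpose_def vec_eq_iff)

lemma transpose_scaleR: "transpose (c *\<^sub>R A) = c *\<^sub>R transpose (A :: real^'p^'n)"
  by (simp add: transpose_def vec_eq_iff)

lemma scaleR_matrix_vector_mult: "(c *\<^sub>R A) *v x = c *\<^sub>R ((A :: real^'p^'n) *v x)"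
  by (simp add: matrix_vector_mult_def vec_eq_iff sum_distrib_left mult.assoc)

lemma subspace_symmetric_matrices_on: "subspace (symmetric_matrices_on P)"
  by (auto simp: subspace_def symmetric_matrices_on_def transpose_add transpose_scaleR
      scaleR_matrix_vector_mult matrix_vector_mult_add_rdistrib)
     (simp add: transpose_def vec_eq_iff)

lemma card_pairs_le: "2 * card {(i, j). i \<le> j \<and> j < (r::nat)} = r * (r + 1)"
proof -
  have "{(i, j). i \<le> j \<and> j < r} = prod.swap ` (SIGMA j:{..<r}. {..j})" by auto
  then have "card {(i, j). i \<le> j \<and> j < r} = card (SIGMA j:{..<r}. {..j})"
    by (metis card_image inj_on_subset inj_swap subset_UNIV)
  also have "\<dots> = (\<Sum>j<r. Suc j)" by simp
  also have "2 * \<dots> = r * (r + 1)" by (induction r) auto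
  finally show ?thesis by simp
qed

text \<open>
  The symmetrised products of basis vectors \<open>f i\<close>, \<open>f j\<close> with \<open>i \<le> j\<close> are nonzero and pairwise
  orthogonal, hence independent.
\<close>

lemma dim_symmetric_matrices_on:
  fixes P :: "(real^'p) set"
  assumes P: "pairwise orthogonal P" and unit: "\<And>b. b \<in> P \<Longrightarrow> norm b = 1"
  shows "card P * (card P + 1) \<le> 2 * dim (symmetric_matrices_on P)"
proof -
  define r where "r = card P"
  have "finite P" using P by (rule pairwise_orthogonal_imp_finite)
  then obtain f where f: "bij_betw f {..<r} P"
    using ex_bij_betw_nat_finite by (auto simp: r_def atLeast0LessThan)
  have inner_f: "f i \<bullet> f j = (if i = j then 1 else 0)" if "i < r" "j < r" for i j
  proof -
    have "f i \<in> P" "f j \<in> P" "f i = f j \<longleftrightarrow> i = j"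
      using f that by (auto simp: bij_betw_def inj_on_def)
    then show ?thesis
      using P unit by (auto simp: pairwise_def orthogonal_def dot_square_norm)
  qed
  define I where "I = {(i, j). i \<le> j \<and> j < r}"
  define E where "E = (\<lambda>(i, j). outer_product (f i) (f j) + outer_product (f j) (f i))"
  have inner_E: "E p \<bullet> E q = 2 * ((f (fst p) \<bullet> f (fst q)) * (f (snd p) \<bullet> f (snd q))
      + (f (fst p) \<bullet> f (snd q)) * (f (snd p) \<bullet> f (fst q)))" for p q
    by (cases p; cases q)
       (simp add: E_def inner_add_left inner_outer_product matrix_vector_mult_add_rdistrib
         outer_product_mult_vector inner_add_right inner_commute algebra_simps)
  have orth: "E p \<bullet> E q = 0" if "p \<in> I" "q \<in> I" "p \<noteq> q" for p q
    using that unfolding inner_E by (cases p; cases q) (auto simp: I_def inner_f)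
  have nz: "E p \<noteq> 0" if "p \<in> I" for p
  proof -
    have "E p \<bullet> E p \<noteq> 0"
      using that unfolding inner_E by (cases p) (auto simp: I_def inner_f)
    then show ?thesis by auto
  qed
  have inj: "inj_on E I"
    using orth nz by (metis (no_types, lifting) inj_onI inner_eq_zero_iff)
  have "independent (E ` I)"
    using orth nz by (intro pairwise_orthogonal_independent) (auto simp: pairwise_def orthogonal_def)
  moreover have "E ` I \<subseteq> symmetric_matrices_on P"
  proof clarify
    fix i j assume "(i, j) \<in> I"
    then have "f i \<in> P" "f j \<in> P" using f by (auto simp: I_def bij_betw_def)
    then show "E (i, j) \<in> symmetric_matrices_on P"
      by (auto simp: E_def symmetric_matrices_on_def transpose_add transpose_outer_product
          add.commute matrix_vector_mult_add_rdistrib outer_product_mult_vector)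
  qed
  ultimately have "card (E ` I) \<le> dim (symmetric_matrices_on P)"
    by (rule independent_card_le_dim[rotated])
  then show ?thesis
    using card_pairs_le[of r] card_image[OF inj] by (simp add: I_def r_def)
qed

text \<open>
  Starting from a form \<open>H\<close> that is positive definite on \<open>R\<close> and moving in a direction \<open>S\<close> that is
  somewhere negative, one meets a form that is still nonnegative but no longer definite.
\<close>

lemma exists_boundary_of_definite_cone:
  fixes H S :: "real^'p^'p"
  assumes R: "subspace R"
    and pos: "\<And>v. v \<in> R \<Longrightarrow> v \<noteq> 0 \<Longrightarrow> 0 < v \<bullet> (H *v v)"
    and neg: "x \<in> R" "x \<bullet> (S *v x) < 0"
  obtains t v where "v \<in> R" "v \<noteq> 0" "v \<bullet> ((H + t *\<^sub>R S) *v v) = 0"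
    "\<And>u. u \<in> R \<Longrightarrow> 0 \<le> u \<bullet> ((H + t *\<^sub>R S) *v u)"
proof -
  let ?K = "sphere 0 1 \<inter> R"
  \<comment> \<open>Nonnegativity at \<open>u\<close> is lost once \<open>t\<close> exceeds \<open>1 / \<rho> u\<close>, if \<open>\<rho> u > 0\<close>. The direction with the
    largest \<open>\<rho>\<close> is thus the first to fail, and scale invariance confines the search to a sphere.\<close>
  define \<rho> where "\<rho> u = - (u \<bullet> (S *v u)) / (u \<bullet> (H *v u))" for u
  have x0: "x \<noteq> 0" using neg by auto
  have inK: "(1 / norm u) *\<^sub>R u \<in> ?K" if "u \<in> R" "u \<noteq> 0" for u
    using that R by (simp add: subspace_scale)
  have \<rho>_scale: "\<rho> ((1 / norm u) *\<^sub>R u) = \<rho> u" if "u \<noteq> 0" for u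
    using that by (simp add: \<rho>_def matrix_vector_mult_scaleR)
  have "compact ?K"
    by (intro compact_Int_closed compact_sphere closed_subspace R)
  moreover have "continuous_on ?K \<rho>"
    unfolding \<rho>_def
    by (intro continuous_intros linear_continuous_on) (use pos in fastforce)+
  moreover have "?K \<noteq> {}" using inK[OF neg(1) x0] by blast
  ultimately obtain v where v: "v \<in> ?K" and max: "\<And>u. u \<in> ?K \<Longrightarrow> \<rho> u \<le> \<rho> v"
    using continuous_attains_sup[of ?K \<rho>] by blast
  have v0: "v \<in> R" "v \<noteq> 0" using v by auto
  have \<rho>_max: "\<rho> u \<le> \<rho> v" if "u \<in> R" "u \<noteq> 0" for u
    using max[OF inK[OF that]] \<rho>_scale[OF that(2)] by simp
  have "0 < \<rho> x" using neg pos[OF neg(1) x0] by (simp add: \<rho>_def divide_neg_pos)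
  then have \<rho>v: "0 < \<rho> v" using \<rho>_max[OF neg(1) x0] by linarith
  have form: "u \<bullet> ((H + (1 / \<rho> v) *\<^sub>R S) *v u) = (u \<bullet> (H *v u)) * (1 - \<rho> u / \<rho> v)"
    if "u \<in> R" "u \<noteq> 0" for u
    using pos[OF that] \<rho>v
    by (simp add: \<rho>_def[of u] matrix_vector_mult_add_rdistrib scaleR_matrix_vector_mult
        inner_add_right divide_simps)
  show thesis
  proof (rule that[OF v0])
    show "v \<bullet> ((H + (1 / \<rho> v) *\<^sub>R S) *v v) = 0" using form[OF v0] \<rho>v by simp
    show "0 \<le> u \<bullet> ((H + (1 / \<rho> v) *\<^sub>R S) *v u)" if "u \<in> R" for u
    proof (cases "u = 0")
      case False
      then have "\<rho> u / \<rho> v \<le> 1" using \<rho>_max[OF that] \<rho>v by simp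
      then show ?thesis
        using form[OF that False] pos[OF that False] by (simp add: mult_nonneg_nonneg)
    qed simp
  qed
qed


text \<open>
  Otherwise all eigenvalues are nonnegative with sum zero, hence zero.
\<close>

lemma exists_negative_direction:
  fixes S :: "real^'p^'p"
  assumes sym: "transpose S = S" and nz: "S \<noteq> 0" and trace: "mat 1 \<bullet> S = 0"
  obtains x where "x \<bullet> (S *v x) < 0"
proof (rule ccontr)
  assume "\<not> thesis"
  then have nonneg: "0 \<le> x \<bullet> (S *v x)" for x using that not_less by blast
  obtain C where C: "orthonormal_basis_of UNIV C" "\<And>c. c \<in> C \<Longrightarrow> S *v c = (c \<bullet> (S *v c)) *\<^sub>R c"
    using spectral_theorem_symmetric_matrix[OF sym] by blast
  have "(\<Sum>c\<in>C. c \<bullet> (S *v c)) = 0"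
    using trace by (simp add: matrix_inner_parseval[OF C(1)])
  then have "\<forall>c\<in>C. c \<bullet> (S *v c) = 0"
    using nonneg onb_finite[OF C(1)] by (subst (asm) sum_nonneg_eq_0_iff) auto
  then have "S *v c = 0" if "c \<in> C" for c
    using C(2)[OF that] that by simp
  then have "S = 0"
    by (intro matrix_eq_on_onb[OF C(1)]) simp
  with nz show False ..
qed

text \<open>
  In an eigenbasis of \<open>Q\<close> the lengths \<open>norm (Q *v c)\<close> are the eigenvalues, whose sum is the trace.
\<close>

lemma nuclear_norm_contraction_mult_semidefinite:
  fixes W :: "real^'p^'n" and Q :: "real^'p^'p"
  assumes W: "\<And>v. norm (W *v v) \<le> norm v" and sym: "transpose Q = Q"
    and psd: "\<And>x. 0 \<le> x \<bullet> (Q *v x)"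
  shows "nuclear_norm (W ** Q) \<le> mat 1 \<bullet> Q"
proof -
  obtain C where C: "orthonormal_basis_of UNIV C" "\<And>c. c \<in> C \<Longrightarrow> Q *v c = (c \<bullet> (Q *v c)) *\<^sub>R c"
    using spectral_theorem_symmetric_matrix[OF sym] by blast
  have "nuclear_norm (W ** Q) \<le> (\<Sum>c\<in>C. norm ((W ** Q) *v c))"
    by (rule nuclear_norm_le_sum_norms[OF C(1)])
  also have "\<dots> \<le> (\<Sum>c\<in>C. c \<bullet> (Q *v c))"
  proof (rule sum_mono)
    fix c assume c: "c \<in> C"
    have "norm ((W ** Q) *v c) \<le> norm (Q *v c)"
      using W by (simp flip: matrix_vector_mul_assoc)
    also have "\<dots> = norm ((c \<bullet> (Q *v c)) *\<^sub>R c)"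
      using C(2)[OF c] by (rule arg_cong)
    also have "\<dots> = c \<bullet> (Q *v c)"
      using onb_norm[OF C(1) c] psd[of c] by simp
    finally show "norm ((W ** Q) *v c) \<le> c \<bullet> (Q *v c)" .
  qed
  also have "\<dots> = mat 1 \<bullet> Q"
    by (simp add: matrix_inner_parseval[OF C(1)])
  finally show ?thesis .
qed

section \<open>Reducing the rank while keeping the observed entries\<close>

lemma rank_le_card_support:
  fixes X :: "real^'p^'n"
  assumes B: "orthonormal_basis_of UNIV B"
  shows "rank X \<le> card {b \<in> B. X *v b \<noteq> 0}"
proof -
  let ?P = "{b \<in> B. X *v b \<noteq> 0}"
  have "finite ?P" using onb_finite[OF B] by simp
  have "X *v v \<in> span ((*v) X ` ?P)" for v
  proof -
    have "X *v v = (\<Sum>b\<in>B. (v \<bullet> b) *\<^sub>R (X *v b))"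
      by (rule onb_expand_linear[OF B]) simp
    also have "\<dots> \<in> span ((*v) X ` ?P)"
    proof (rule span_sum)
      fix b assume "b \<in> B"
      then show "(v \<bullet> b) *\<^sub>R (X *v b) \<in> span ((*v) X ` ?P)"
        by (cases "X *v b = 0") (auto simp: span_zero intro: span_scale span_base)
    qed
    finally show ?thesis .
  qed
  then have "rank X \<le> card ((*v) X ` ?P)"
    unfolding rank_dim_range using \<open>finite ?P\<close> by (intro dim_le_card) auto
  also have "\<dots> \<le> card ?P" by (rule card_image_le[OF \<open>finite ?P\<close>])
  finally show ?thesis .
qed

text \<open>
  Move along \<open>W ** (H + t *\<^sub>R S)\<close>, where \<open>X = W ** H\<close> is the polar decomposition. Each observed
  entry of \<open>W ** S\<close> and the trace of \<open>S\<close> is one linear functional of \<open>S\<close>, so \<open>card \<Omega> + 1\<close> equations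
  have to be solved in a space of dimension \<open>rank X * (rank X + 1) / 2\<close>.
\<close>

proposition rank_reduction:
  fixes X :: "real^'p^'n" and \<Omega> :: "('n \<times> 'p) set"
  assumes large: "2 * (card \<Omega> + 1) < rank X * (rank X + 1)"
  obtains Y where "rank Y < rank X" "nuclear_norm Y \<le> nuclear_norm X" "agrees_on \<Omega> X Y"
proof -
  obtain B where B: "singular_basis X B" by (rule exists_singular_basis)
  note onb = singular_basis_onb[OF B]
  note finB = singular_basis_finite[OF B]
  define P where "P = {b \<in> B. X *v b \<noteq> 0}"
  define R where "R = span P"
  define W where "W = polar_factor X B"
  \<comment> \<open>\<open>H\<close> is the positive semidefinite square root of \<open>transpose X ** X\<close>.\<close>
  define H where "H = (\<Sum>b\<in>B. norm (X *v b) *\<^sub>R outer_product b b)"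

  have H_apply: "H *v x = (\<Sum>b\<in>B. (norm (X *v b) * (b \<bullet> x)) *\<^sub>R b)" for x
    by (simp add: H_def sum_matrix_vector_mult scaleR_matrix_vector_mult outer_product_mult_vector)
  have H_basis: "H *v b = norm (X *v b) *\<^sub>R b" if "b \<in> B" for b
  proof -
    have "H *v b = (\<Sum>c\<in>B. if c = b then norm (X *v b) *\<^sub>R b else 0)"
      unfolding H_apply using that by (intro sum.cong) (auto simp: onb_inner[OF onb])
    then show ?thesis using that finB by simp
  qed
  have WH: "W ** H = X"
  proof (rule matrix_eq_on_onb[OF onb])
    fix b assume b: "b \<in> B"
    then show "(W ** H) *v b = X *v b"
      by (simp add: H_basis W_def polar_factor_basis[OF B] matrix_vector_mult_scaleR
          flip: matrix_vector_mul_assoc)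
  qed
  have trace_H: "mat 1 \<bullet> H = nuclear_norm X"
    by (simp add: matrix_inner_parseval[OF onb] nuclear_norm_singular_basis[OF B] H_basis
        dot_square_norm singular_basis_norm[OF B])
  have H_sym: "transpose H = H"
    by (simp add: H_def linear_sum[of transpose] transpose_scaleR transpose_outer_product
        linearI transpose_add)
  have H_form: "v \<bullet> (H *v v) = (\<Sum>b\<in>B. norm (X *v b) * (b \<bullet> v)\<^sup>2)" for v
    by (simp add: H_apply inner_sum_right power2_eq_square inner_commute mult.assoc)
  have R_subspace: "subspace R" by (simp add: R_def)
  have R_perp: "v = 0" if "v \<in> R" "\<And>b. b \<in> P \<Longrightarrow> b \<bullet> v = 0" for v
  proof -
    have "orthogonal v v"
      using that unfolding R_def by (metis orthogonal_commute orthogonal_def orthogonal_to_span)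
    then show ?thesis by (simp add: orthogonal_def)
  qed
  have H_pos: "0 < v \<bullet> (H *v v)" if "v \<in> R" "v \<noteq> 0" for v
  proof -
    have "0 \<le> v \<bullet> (H *v v)" unfolding H_form by (intro sum_nonneg) auto
    moreover have "v \<bullet> (H *v v) \<noteq> 0"
    proof
      assume "v \<bullet> (H *v v) = 0"
      then have "\<forall>b\<in>B. norm (X *v b) * (b \<bullet> v)\<^sup>2 = 0"
        unfolding H_form using finB by (subst (asm) sum_nonneg_eq_0_iff) auto
      then show False using R_perp[OF that(1)] that(2) by (auto simp: P_def)
    qed
    ultimately show ?thesis by simp
  qed
  have H_perp: "H *v w = 0" if "\<And>b. b \<in> P \<Longrightarrow> b \<bullet> w = 0" for w
    unfolding H_apply using that by (intro sum.neutral) (auto simp: P_def)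

  \<comment> \<open>Representing matrices of the functionals that \<open>S\<close> has to annihilate: \<open>mat 1\<close> for the trace, the
    others for the entries of \<open>W ** S\<close> in \<open>\<Omega>\<close>.\<close>
  define K where "K = insert (mat 1)
    ((\<lambda>(i, j). outer_product (transpose W *v axis i 1) (axis j 1)) ` \<Omega>)"
  have "finite K" by (simp add: K_def)
  have "card K \<le> card \<Omega> + 1"
    unfolding K_def by (simp add: card_insert_if card_image_le le_SucI)
  then have "2 * card K \<le> 2 * (card \<Omega> + 1)" by simp
  also have "\<dots> < rank X * (rank X + 1)" by (rule large)
  also have "\<dots> \<le> card P * (card P + 1)"
    using rank_le_card_support[OF onb, of X] by (intro mult_le_mono) (auto simp: P_def)
  also have "\<dots> \<le> 2 * dim (symmetric_matrices_on P)"
    using onb by (intro dim_symmetric_matrices_on)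
      (auto simp: P_def orthonormal_basis_of_def pairwise_def)
  finally have "card K < dim (symmetric_matrices_on P)" by simp
  then obtain S where S: "S \<in> symmetric_matrices_on P" "S \<noteq> 0" and SK: "\<And>M. M \<in> K \<Longrightarrow> M \<bullet> S = 0"
    using exists_orthogonal_in_large_subspace[OF subspace_symmetric_matrices_on \<open>finite K\<close>] by blast
  have S_sym: "transpose S = S" using S by (simp add: symmetric_matrices_on_def)
  have S_perp: "S *v w = 0" if "\<And>b. b \<in> P \<Longrightarrow> b \<bullet> w = 0" for w
    using S that by (simp add: symmetric_matrices_on_def)
  have trace_S: "mat 1 \<bullet> S = 0" by (rule SK) (simp add: K_def)
  have WS: "(W ** S) $ i $ j = 0" if "(i, j) \<in> \<Omega>" for i j
  proof -
    have "0 = outer_product (transpose W *v axis i 1) (axis j 1) \<bullet> S"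
      using that by (intro SK[symmetric]) (force simp: K_def)
    also have "\<dots> = axis i 1 \<bullet> (W *v (S *v axis j 1))"
      by (simp only: inner_outer_product matrix_vector_inner_transpose)
    also have "\<dots> = axis i 1 \<bullet> ((W ** S) *v axis j 1)"
      by (simp only: matrix_vector_mul_assoc)
    also have "\<dots> = (W ** S) $ i $ j"
      by (simp add: inner_axis' matrix_vector_mult_basis column_def)
    finally show ?thesis by simp
  qed

  \<comment> \<open>The form of a symmetric matrix that vanishes on the complement of \<open>R\<close> depends only on the
    projection to \<open>R\<close>. The projection is chosen before \<open>M\<close>, and the fact is used for \<open>S\<close> and for \<open>Q\<close>.\<close>
  have decomp: "\<exists>y\<in>R. \<forall>M. transpose M = M \<longrightarrow> (\<forall>w. (\<forall>b\<in>P. b \<bullet> w = 0) \<longrightarrow> M *v w = 0)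
      \<longrightarrow> x \<bullet> (M *v x) = y \<bullet> (M *v y)" for x :: "real^'p"
  proof -
    obtain y z where yz: "y \<in> R" "\<And>w. w \<in> R \<Longrightarrow> orthogonal z w" "x = y + z"
      using orthogonal_subspace_decomp_exists[of P x] unfolding R_def by blast
    have z: "b \<bullet> z = 0" if "b \<in> P" for b
      using yz(2)[of b] that by (simp add: R_def span_base orthogonal_def inner_commute)
    have "x \<bullet> (M *v x) = y \<bullet> (M *v y)"
      if "transpose M = M" "\<forall>w. (\<forall>b\<in>P. b \<bullet> w = 0) \<longrightarrow> M *v w = 0" for M
    proof -
      have "M *v z = 0" using that z by blast
      moreover have "z \<bullet> (M *v y) = (M *v z) \<bullet> y"
        using matrix_vector_inner_transpose[of z M y] that by simp
      ultimately show ?thesis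
        by (simp add: yz(3) matrix_vector_right_distrib inner_add_left)
    qed
    then show ?thesis using yz(1) by blast
  qed

  obtain x0 where "x0 \<bullet> (S *v x0) < 0"
    using exists_negative_direction[OF S_sym S(2) trace_S] by blast
  then obtain x where x: "x \<in> R" "x \<bullet> (S *v x) < 0"
    using decomp[of x0] S_sym S_perp by metis
  obtain t v where v: "v \<in> R" "v \<noteq> 0" "v \<bullet> ((H + t *\<^sub>R S) *v v) = 0"
    and psd_R: "\<And>u. u \<in> R \<Longrightarrow> 0 \<le> u \<bullet> ((H + t *\<^sub>R S) *v u)"
    using exists_boundary_of_definite_cone[OF R_subspace H_pos x] by blast
  define Q where "Q = H + t *\<^sub>R S"
  have Q_sym: "transpose Q = Q" by (simp add: Q_def transpose_add transpose_scaleR H_sym S_sym)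
  have Q_perp: "Q *v w = 0" if "\<And>b. b \<in> P \<Longrightarrow> b \<bullet> w = 0" for w
    using that by (simp add: Q_def matrix_vector_mult_add_rdistrib scaleR_matrix_vector_mult H_perp S_perp)
  have psd: "0 \<le> x \<bullet> (Q *v x)" for x
    using decomp[of x] Q_sym Q_perp psd_R unfolding Q_def by metis
  have Q_adj: "x \<bullet> (Q *v y) = (Q *v x) \<bullet> y" for x y
    by (simp only: matrix_vector_inner_transpose[of x Q y] Q_sym)
  have Qv: "Q *v v = 0"
    by (rule semidefinite_zero_imp_kernel[of "(*v) Q" UNIV])
       (use Q_adj psd v(3) in \<open>simp_all only: Q_def[symmetric] matrix_vector_mul_linear
         subspace_UNIV subset_UNIV UNIV_I\<close>)

  define Y where "Y = W ** Q"
  have Y_eq: "Y = X + t *\<^sub>R (W ** S)"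
    by (simp add: Y_def Q_def WH matrix_add_ldistrib matrix_scalar_ac
        scalar_matrix_assoc flip: scalar_mult_eq_scaleR)
  show thesis
  proof (rule that[of Y])
    have "nuclear_norm Y \<le> mat 1 \<bullet> Q"
      unfolding Y_def using polar_factor_contraction[OF B]
      by (intro nuclear_norm_contraction_mult_semidefinite Q_sym psd) (simp add: W_def)
    also have "\<dots> = nuclear_norm X"
      by (simp add: Q_def inner_add_right trace_H trace_S)
    finally show "nuclear_norm Y \<le> nuclear_norm X" .
    show "agrees_on \<Omega> X Y" using WS by (auto simp: agrees_on_def Y_eq)
    have X_ker: "b \<bullet> x = 0" if "X *v x = 0" "b \<in> P" for x b
    proof -
      have "x \<bullet> ((transpose X ** X) *v b) = 0" using that by (simp only: inner_gram_matrix inner_zero_left)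
      then have "(norm (X *v b))\<^sup>2 * (x \<bullet> b) = 0" using that B by (simp add: singular_basis_def P_def)
      then show ?thesis using that by (simp add: P_def inner_commute)
    qed
    have "{x. X *v x = 0} \<subset> {x. Y *v x = 0}"
    proof (rule psubsetI)
      show "{x. X *v x = 0} \<subseteq> {x. Y *v x = 0}"
        using X_ker Q_perp by (auto simp: Y_def simp flip: matrix_vector_mul_assoc)
      have "X *v v \<noteq> 0" using R_perp[OF v(1)] X_ker v(2) by blast
      moreover have "Y *v v = 0" using Qv by (simp add: Y_def flip: matrix_vector_mul_assoc)
      ultimately show "{x. X *v x = 0} \<noteq> {x. Y *v x = 0}" by auto
    qed
    then show "rank Y < rank X" by (rule rank_less_if_kernel_less)
  qed
qed

section \<open>Minimisers of the nuclear norm\<close>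

text \<open>
  The matrix \<open>A\<close> satisfies the constraints itself, so only matrices with at most its nuclear norm
  compete, and these form a compact set.
\<close>

lemma exists_min_nuclear_norm:
  fixes A :: "real^'p^'n"
  obtains X where "agrees_on \<Omega> A X" "\<And>Y. agrees_on \<Omega> A Y \<Longrightarrow> nuclear_norm X \<le> nuclear_norm Y"
proof -
  have cont: "continuous_on UNIV (nuclear_norm :: real^'p^'n \<Rightarrow> real)"
    by (intro convex_on_continuous convex_on_nuclear_norm) simp
  define K where "K = {X. agrees_on \<Omega> A X} \<inter> {X. nuclear_norm X \<le> nuclear_norm A}"
  have "{X. agrees_on \<Omega> A X} = (\<Inter>(i, j)\<in>\<Omega>. {X. X $ i $ j = A $ i $ j})"
    by (auto simp: agrees_on_def)
  also have "closed \<dots>"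
    by (intro closed_INT ballI) (auto intro!: closed_Collect_eq continuous_intros)
  finally have "closed K"
    unfolding K_def by (intro closed_Int closed_Collect_le cont continuous_intros)
  moreover have "bounded K"
    unfolding K_def bounded_iff using norm_le_nuclear_norm order_trans by blast
  ultimately have "compact K" by (simp add: compact_eq_bounded_closed)
  moreover have A: "A \<in> K" by (auto simp: K_def agrees_on_def)
  ultimately obtain X where X: "X \<in> K" "\<And>Y. Y \<in> K \<Longrightarrow> nuclear_norm X \<le> nuclear_norm Y"
    using continuous_attains_inf[of K nuclear_norm] continuous_on_subset[OF cont] by blast
  show thesis
  proof (rule that[of X])
    show "agrees_on \<Omega> A X" using X by (simp add: K_def)
    show "nuclear_norm X \<le> nuclear_norm Y" if "agrees_on \<Omega> A Y" for Y
      using X(2)[of Y] X(2)[OF A] that by (cases "nuclear_norm Y \<le> nuclear_norm A") (auto simp: K_def)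
  qed
qed

text \<open>
  A minimiser of least rank, as any further rank reduction would produce another minimiser.
\<close>

lemma exists_low_rank_minimizer:
  fixes A :: "real^'p^'n"
  obtains X where "agrees_on \<Omega> A X" "\<And>Y. agrees_on \<Omega> A Y \<Longrightarrow> nuclear_norm X \<le> nuclear_norm Y"
    "rank X * (rank X + 1) \<le> 2 * (card \<Omega> + 1)"
proof -
  define opt where "opt X \<longleftrightarrow> agrees_on \<Omega> A X \<and>
    (\<forall>Y. agrees_on \<Omega> A Y \<longrightarrow> nuclear_norm X \<le> nuclear_norm Y)" for X
  have "\<exists>X. opt X" using exists_min_nuclear_norm unfolding opt_def by blast
  then obtain X where X: "opt X" "\<And>Y. opt Y \<Longrightarrow> rank X \<le> rank Y"
    using ex_has_least_nat[of opt _ rank] by blast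
  have "\<not> 2 * (card \<Omega> + 1) < rank X * (rank X + 1)"
  proof
    assume "2 * (card \<Omega> + 1) < rank X * (rank X + 1)"
    then obtain Y where Y: "rank Y < rank X" "nuclear_norm Y \<le> nuclear_norm X" "agrees_on \<Omega> X Y"
      by (rule rank_reduction)
    have "agrees_on \<Omega> A Y" using X(1) Y(3) by (fastforce simp: opt_def agrees_on_def)
    then have "opt Y" using X(1) Y(2) unfolding opt_def by (meson order_trans)
    then show False using X(2) Y(1) by force
  qed
  then show thesis using that[of X] X(1) unfolding opt_def by auto
qed

theorem corollary5:
  fixes A :: "real^'p^'n" and \<Omega> :: "('n \<times> 'p) set" and k :: nat
  assumes "1 \<le> k" and "k \<le> CARD('n)" and "CARD('n) \<le> CARD('p)"
  shows "(\<forall>z\<ge>0. convex hull (low_rank_ball k z) = {X :: real^'p^'n. nuclear_norm X \<le> z})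
    \<and> (\<exists>X z. optimal_solution (MCR_feasible k \<Omega> A) X z
          \<and> int (rank X) \<le> \<lfloor>sqrt (2 * real (card \<Omega>) + 9 / 4) - 1 / 2\<rfloor>)
    \<and> (real (card \<Omega>) \<le> (real k + 1) * (real k + 2) / 2 - 2 \<longrightarrow>
          optimal_value (MCR_feasible k \<Omega> A) = optimal_value (MC_feasible k \<Omega> A))"
proof -
  note hull = convex_hull_low_rank_ball[OF assms(1)]
  obtain X where X: "agrees_on \<Omega> A X" "\<And>Y. agrees_on \<Omega> A Y \<Longrightarrow> nuclear_norm X \<le> nuclear_norm Y"
    and bound: "rank X * (rank X + 1) \<le> 2 * (card \<Omega> + 1)"
    using exists_low_rank_minimizer[of \<Omega> A] by blast
  let ?z = "nuclear_norm X"
  have opt: "optimal_solution (MCR_feasible k \<Omega> A) X ?z"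
    unfolding optimal_solution_def MCR_feasible_def hull
    using X nuclear_norm_nonneg[of X] by (auto intro: order_trans)
  have bound': "real (rank X) * (real (rank X) + 1) \<le> 2 * (real (card \<Omega>) + 1)"
    using of_nat_mono[OF bound, where 'a = real] by (simp add: algebra_simps)
  \<comment> \<open>Complete the square: \<open>r * (r + 1) + 1 / 4 = (r + 1 / 2)\<^sup>2\<close>.\<close>
  have "real (rank X) + 1 / 2 \<le> sqrt (2 * real (card \<Omega>) + 9 / 4)"
    using bound' by (intro real_le_rsqrt) (simp add: power2_eq_square algebra_simps)
  then have rank_bound: "int (rank X) \<le> \<lfloor>sqrt (2 * real (card \<Omega>) + 9 / 4) - 1 / 2\<rfloor>"
    by (simp add: le_floor_iff)
  have "optimal_value (MCR_feasible k \<Omega> A) = optimal_value (MC_feasible k \<Omega> A)"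
    if m: "real (card \<Omega>) \<le> (real k + 1) * (real k + 2) / 2 - 2"
  proof (rule antisym)
    have "MC_feasible k \<Omega> A \<subseteq> MCR_feasible k \<Omega> A"
      by (auto simp: MC_feasible_def MCR_feasible_def hull_inc)
    then show "optimal_value (MCR_feasible k \<Omega> A) \<le> optimal_value (MC_feasible k \<Omega> A)"
      unfolding optimal_value_def by (rule INF_superset_mono) simp
    have "rank X \<le> k"
    proof (rule ccontr)
      assume "\<not> rank X \<le> k"
      then have "(real k + 1) * (real k + 2) \<le> real (rank X) * (real (rank X) + 1)"
        by (intro mult_mono) auto
      then show False using bound' m by (simp add: field_simps)
    qed
    then have "(X, ?z) \<in> MC_feasible k \<Omega> A"
      using X nuclear_norm_nonneg[of X] by (simp add: MC_feasible_def low_rank_ball_def)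
    then have "optimal_value (MC_feasible k \<Omega> A) \<le> ereal ?z"
      unfolding optimal_value_def by (rule INF_lower2) simp
    also have "ereal ?z \<le> optimal_value (MCR_feasible k \<Omega> A)"
      unfolding optimal_value_def
      using opt by (intro INF_greatest) (auto simp: optimal_solution_def)
    finally show "optimal_value (MC_feasible k \<Omega> A) \<le> optimal_value (MCR_feasible k \<Omega> A)" .
  qed
  then show ?thesis using hull opt rank_bound by blast
qed

end
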